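(* Let $D$ be a digraph. If $D$ is not $\Delta_{\min}(D)$-dicolourable, then one of the following holds: (1) $\Delta_{\min}(D) \leq 1$; or (2) $\Delta_{\min}(D) = 2$ and $D$ contains $\overleftrightarrow{K_2}$ as a subdigraph; or (3) $\Delta_{\min}(D) \geq 3$ and $D$ contains $\overleftrightarrow{K_r} \Rightarrow \overleftrightarrow{K_s}$ as a subdigraph, for some integers $r,s \geq 0$ such that $r+s = \Delta_{\min}(D)+1$.
   Context: Digraphs are finite, without loops or parallel arcs; two arcs in opposite directions between the same two vertices are allowed. For a vertex $v$, $d^+(v)$ and $d^-(v)$ denote its out-degree and in-degree, $d_{\min}(v)=\min\{d^+(v),d^-(v)\}$, and $\Delta_{\min}(D)=\max_{v\in V(D)} d_{\min}(v)$. A $k$-dicolouring of $D$ is a function $c:V(D)\to\{1,\dots,k\}$ such that for each $i$ the set $c^{-1}(i)$ induces a subdigraph with no directed cycle (a pair of opposite arcs between two vertices is a directed cycle of length 2); $D$ is $k$-dicolourable if it has a $k$-dicolouring. For a graph $G$, $\overleftrightarrow{G}$ is the digraph obtained from $G$ by replacing every edge by two arcs in opposite directions; $K_r$ is the complete graph on $r$ vertices ($K_0$ is empty). The directed join $H_1\Rightarrow H_2$ is obtained from disjoint copies of digraphs $H_1$ and $H_2$ (either may be empty) by adding all arcs from the copy of $H_1$ to the copy of $H_2$. Subdigraphs are not required to be induced. *)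

theory Defs
  imports "Graph_Theory.Digraph_Isomorphism" "Graph_Theory.Kuratowski"
begin

definition min_degree :: "('a, 'b) pre_digraph \<Rightarrow> 'a \<Rightarrow> nat" where
  "min_degree G v = min (out_degree G v) (in_degree G v)"

text \<open>The \<open>0\<close> only matters for the null digraph, whose maximum would otherwise be unspecified.\<close>

definition max_min_degree :: "('a, 'b) pre_digraph \<Rightarrow> nat" where
  "max_min_degree G = Max (insert 0 (min_degree G ` verts G))"

text \<open>
  \<^const>\<open>pre_digraph.cycle\<close> is about arc walks that follow the direction of the arcs, so it means a
  directed cycle; two opposite arcs form a cycle of length 2.
\<close>

definition dicolouring :: "('a, 'b) pre_digraph \<Rightarrow> nat \<Rightarrow> ('a \<Rightarrow> nat) \<Rightarrow> bool" where
  "dicolouring G k c \<longleftrightarrow> c \<in> verts G \<rightarrow> {1..k} \<and>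
     (\<forall>i\<in>{1..k}. \<nexists>p. pre_digraph.cycle (G \<restriction> {v \<in> verts G. c v = i}) p)"

definition dicolourable :: "('a, 'b) pre_digraph \<Rightarrow> nat \<Rightarrow> bool" where
  "dicolourable G k \<longleftrightarrow> (\<exists>c. dicolouring G k c)"

definition bidirected_complete :: "nat \<Rightarrow> nat pair_pre_digraph" where
  "bidirected_complete r = \<lparr> pverts = {..<r}, parcs = {(u, v). u < r \<and> v < r \<and> u \<noteq> v} \<rparr>"

definition directed_join ::
    "'a pair_pre_digraph \<Rightarrow> 'b pair_pre_digraph \<Rightarrow> ('a + 'b) pair_pre_digraph" where
  "directed_join G H = \<lparr> pverts = pverts G <+> pverts H,
     parcs = map_prod Inl Inl ` parcs G \<union> map_prod Inr Inr ` parcs H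
       \<union> (Inl ` pverts G) \<times> (Inr ` pverts H) \<rparr>"

text \<open>Containment is up to isomorphism; \<^const>\<open>subgraph\<close> does not require induced subdigraphs.\<close>

definition contains_subdigraph :: "('a, 'b) pre_digraph \<Rightarrow> ('c, 'd) pre_digraph \<Rightarrow> bool" where
  "contains_subdigraph G H \<longleftrightarrow> (\<exists>H'. subgraph H' G \<and> digraph_iso H H')"

lemma complete_digraph_bidirected_complete:
  "complete_digraph r (with_proj (bidirected_complete r))"
  by (auto simp: complete_digraph_pair_def bidirected_complete_def)

lemma pair_digraph_directed_join:
  assumes "pair_digraph G" "pair_digraph H"
  shows "pair_digraph (directed_join G H)"
proof -
  interpret G: pair_digraph G by fact
  interpret H: pair_digraph H by fact
  show ?thesis
    by unfold_locales
       (auto simp: directed_join_def G.wellformed' H.wellformed' G.pair_finite_verts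
          H.pair_finite_verts G.pair_finite_arcs H.pair_finite_arcs
          dest: G.pair_no_loops H.pair_no_loops)
qed

end

theory Submission
  imports Defs "HOL-Combinatorics.Transposition"
begin

text \<open>
  Let \<open>k\<close> be the maximum of the minimum degrees, let \<open>X\<close> be the set of vertices of out-degree at most \<open>k\<close>,
  and let \<open>Y\<close> be the remaining vertices, which have in-degree at most \<open>k\<close>. Turn every arc from \<open>X\<close> to \<open>Y\<close>
  into a digon (a pair of opposite arcs) and delete every arc from \<open>Y\<close> to \<open>X\<close>. A dicolouring of the new digraph also
  dicolours the old one: a monochromatic directed cycle that meets both parts uses an arc from \<open>X\<close> to
  \<open>Y\<close>, and the two ends of that arc have different colours (\<open>dicol_digonify\<close>). So the new digraph has no
  \<open>k\<close>-dicolouring, and a minimal set \<open>W\<close> of vertices induces a critical subdigraph. Critical digraphs have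
  all degrees at least \<open>k\<close>. The construction did not increase the out-degrees in \<open>X\<close> nor the in-degrees in
  \<open>Y\<close>, so these are exactly \<open>k\<close> in \<open>W\<close>; as arcs between the two parts come in digons, counting arcs
  shows that the other degrees are \<open>k\<close> as well (\<open>regular_of_partition\<close>).

  This leaves a directed Brooks theorem for \<open>k\<close>-regular critical digraphs. For \<open>k \<ge> 2\<close> such a digraph is
  symmetric (\<open>arcs_symmetric\<close>), and for \<open>k \<ge> 3\<close> it is complete (\<open>complete\<close>). Both facts use one principle:
  if everything except a vertex \<open>z\<close> is coloured, then \<open>z\<close> sees every colour exactly once among its
  out-neighbours. A digraph can be coloured greedily towards \<open>z\<close> as long as the uncoloured part is
  connected (\<open>greedy_extension\<close>), so a suitable precolouring of one or two vertices next to \<open>z\<close>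
  leads to a dicolouring of all vertices: precolour the end \<open>x\<close> of an arc \<open>z \<rightarrow> x\<close> without reverse, or, as in Lovasz's proof of Brooks' theorem, two
  nonadjacent neighbours of \<open>z\<close>. The connectivity that this needs, namely that deleting one vertex, or two
  nonadjacent vertices in the symmetric case, does not disconnect, comes from permuting
  colours on one side of a cut (\<open>strongly_connected_minus_vertex\<close>, \<open>connected_minus_nonadjacent_pair\<close>).

  If \<open>k = 2\<close>, then some digon of \<open>W\<close> lies inside \<open>X\<close> or inside \<open>Y\<close>, because otherwise \<open>W\<close> is bipartite
  and 2-colourable; arcs inside a part were not changed, so this digon is in the original digraph. If
  \<open>k \<ge> 3\<close>, then \<open>W\<close> is complete on \<open>k + 1\<close> vertices, and in the original digraph \<open>W \<inter> X\<close> and \<open>W \<inter> Y\<close> are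
  bidirected cliques with all arcs from the first to the second.
\<close>

section \<open>Dicolourings of a relation\<close>

text \<open>
  A closed walk that left \<open>A\<close> could not return to it, so every cycle lies on one side of the cut.
\<close>

lemma acyclic_cut:
  assumes "acyclic (r \<inter> A \<times> A)" "acyclic (r \<inter> (- A) \<times> (- A))"
    and cut: "\<And>u v. (u, v) \<in> r \<Longrightarrow> u \<notin> A \<Longrightarrow> v \<notin> A"
  shows "acyclic r"
proof (rule acyclicI, rule allI, rule notI)
  fix a assume cyc: "(a, a) \<in> r\<^sup>+"
  have out: "b \<notin> A \<and> (a, b) \<in> (r \<inter> (- A) \<times> (- A))\<^sup>+" if "(a, b) \<in> r\<^sup>+" "a \<notin> A" for a b
    using that
  proof (induction rule: trancl_induct)
    case (base y)
    then show ?case using cut by blast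
  next
    case (step y z)
    then have "(y, z) \<in> r \<inter> (- A) \<times> (- A)" using cut by blast
    with step show ?case by (meson IntD2 SigmaD2 ComplD trancl_into_trancl)
  qed
  have inn: "a \<in> A \<and> (a, b) \<in> (r \<inter> A \<times> A)\<^sup>+" if "(a, b) \<in> r\<^sup>+" "b \<in> A" for a b
    using that
  proof (induction rule: converse_trancl_induct)
    case (base y)
    then show ?case using cut by blast
  next
    case (step y z)
    then have "(y, z) \<in> r \<inter> A \<times> A" using cut by blast
    with step show ?case by (meson IntD2 SigmaD1 trancl_into_trancl2)
  qed
  show False
    using cyc out[of a a] inn[of a a] assms(1,2) by (cases "a \<in> A") (auto simp: acyclic_def)
qed

definition mono_arcs :: "('a \<times> 'a) set \<Rightarrow> 'a set \<Rightarrow> ('a \<Rightarrow> nat) \<Rightarrow> ('a \<times> 'a) set" where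
  "mono_arcs E S c = {(u, v) \<in> E. u \<in> S \<and> v \<in> S \<and> c u = c v}"

text \<open>
  Arcs are pairs, and the coloured vertex set \<open>S\<close> is a parameter separate from the arc set. Partial colourings
  and colourings of induced subdigraphs are then the same thing.
\<close>

definition dicol :: "('a \<times> 'a) set \<Rightarrow> nat \<Rightarrow> 'a set \<Rightarrow> ('a \<Rightarrow> nat) \<Rightarrow> bool" where
  "dicol E k S c \<longleftrightarrow> c ` S \<subseteq> {1..k} \<and> acyclic (mono_arcs E S c)"

lemma dicol_cong:
  assumes "\<And>v. v \<in> S \<Longrightarrow> c v = c' v"
  shows "dicol E k S c \<longleftrightarrow> dicol E k S c'"
proof -
  have "mono_arcs E S c = mono_arcs E S c'" "c ` S = c' ` S"
    using assms by (auto simp: mono_arcs_def)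
  then show ?thesis by (simp add: dicol_def)
qed

lemma dicol_subset: "dicol E k S c \<Longrightarrow> T \<subseteq> S \<Longrightarrow> dicol E k T c"
  unfolding dicol_def by (auto elim!: acyclic_subset simp: mono_arcs_def)

lemma dicol_converse: "dicol (E\<inverse>) k S c \<longleftrightarrow> dicol E k S c"
proof -
  have "mono_arcs (E\<inverse>) S c = (mono_arcs E S c)\<inverse>" by (auto simp: mono_arcs_def)
  then show ?thesis by (simp add: dicol_def)
qed

lemma dicol_permute:
  assumes "dicol E k S c" "\<pi> ` {1..k} \<subseteq> {1..k}" "inj_on \<pi> {1..k}"
  shows "dicol E k S (\<pi> \<circ> c)"
proof -
  have c: "c ` S \<subseteq> {1..k}" using assms(1) by (simp add: dicol_def)
  have "\<pi> (c u) = \<pi> (c v) \<longleftrightarrow> c u = c v" if "u \<in> S" "v \<in> S" for u v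
    using that c by (intro inj_on_eq_iff[OF assms(3)]) blast+
  then have "mono_arcs E S (\<pi> \<circ> c) = mono_arcs E S c"
    unfolding mono_arcs_def comp_def by blast
  moreover have "(\<pi> \<circ> c) ` S \<subseteq> {1..k}" using c assms(2) by (simp add: image_comp[symmetric]) blast
  ultimately show ?thesis using assms(1) by (simp add: dicol_def)
qed

lemma dicol_transpose:
  assumes "dicol E k S c" "i \<in> {1..k}" "j \<in> {1..k}"
  shows "dicol E k S (transpose i j \<circ> c)"
proof (rule dicol_permute[OF assms(1)])
  show "transpose i j ` {1..k} \<subseteq> {1..k}"
    using assms(2,3) by (intro image_subsetI) (simp add: transpose_def)
  show "inj_on (transpose i j) {1..k}" by (rule inj_on_transpose)
qed

lemma dicol_Un:
  assumes "dicol E k A c" "dicol E k B c"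
    and no_arc: "\<And>u v. (u, v) \<in> E \<Longrightarrow> u \<in> B - A \<Longrightarrow> v \<in> A \<Longrightarrow> c u \<noteq> c v"
  shows "dicol E k (A \<union> B) c"
proof -
  let ?r = "mono_arcs E (A \<union> B) c"
  have "acyclic ?r"
  proof (rule acyclic_cut[of _ A])
    show "acyclic (?r \<inter> A \<times> A)"
      by (rule acyclic_subset[of "mono_arcs E A c"]) (use assms in \<open>auto simp: dicol_def mono_arcs_def\<close>)
    show "acyclic (?r \<inter> (- A) \<times> (- A))"
      by (rule acyclic_subset[of "mono_arcs E B c"]) (use assms in \<open>auto simp: dicol_def mono_arcs_def\<close>)
  qed (use no_arc in \<open>auto simp: mono_arcs_def\<close>)
  then show ?thesis using assms by (auto simp: dicol_def)
qed

text \<open>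
  A colour that is absent among the out-neighbours of \<open>v\<close>, or among its in-neighbours, is free for
  \<open>v\<close>: no monochromatic cycle can pass through \<open>v\<close>. This is the greedy step for dicolourings.
\<close>

lemma dicol_insert_out:
  assumes "dicol E k S c" "v \<notin> S" "(v, v) \<notin> E" "i \<in> {1..k}"
    and "\<And>u. u \<in> S \<Longrightarrow> (v, u) \<in> E \<Longrightarrow> c u \<noteq> i"
  shows "dicol E k (insert v S) (c(v := i))"
proof -
  have "dicol E k S (c(v := i))"
    using assms(1,2) by (subst dicol_cong[of _ _ c]) auto
  moreover have "mono_arcs E {v} (c(v := i)) = {}"
    using assms(3) by (auto simp: mono_arcs_def)
  then have "dicol E k {v} (c(v := i))"
    using assms(4) by (simp add: dicol_def acyclic_def)
  ultimately have "dicol E k (S \<union> {v}) (c(v := i))"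
    by (rule dicol_Un) (use assms in \<open>auto dest!: assms(5)\<close>)
  then show ?thesis by simp
qed

lemma dicol_insert_in:
  assumes "dicol E k S c" "v \<notin> S" "(v, v) \<notin> E" "i \<in> {1..k}"
    and "\<And>u. u \<in> S \<Longrightarrow> (u, v) \<in> E \<Longrightarrow> c u \<noteq> i"
  shows "dicol E k (insert v S) (c(v := i))"
  using dicol_insert_out[of "E\<inverse>" k S c v i] assms by (simp add: dicol_converse)

text \<open>
  No directed cycle crosses a cut whose arcs all point the same way, so colours may be exchanged on one side of it.
\<close>

lemma dicol_recolour_part:
  assumes "dicol E k R c" "dicol E k T c" "R \<inter> T = {}"
    and "\<And>u v. (u, v) \<in> E \<Longrightarrow> u \<in> T \<Longrightarrow> v \<notin> R"
    and "i \<in> {1..k}" "j \<in> {1..k}"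
  shows "dicol E k (R \<union> T) (\<lambda>v. if v \<in> R then transpose i j (c v) else c v)" (is "dicol _ _ _ ?c")
proof (rule dicol_Un)
  show "dicol E k R ?c"
    using dicol_transpose[OF assms(1,5,6)] by (subst dicol_cong[of _ _ "transpose i j \<circ> c"]) auto
  show "dicol E k T ?c"
    using assms(2,3) by (subst dicol_cong[of _ _ c]) auto
qed (use assms(4) in auto)

lemma dicol_digon:
  assumes "dicol E k S c" "u \<in> S" "v \<in> S" "(u, v) \<in> E" "(v, u) \<in> E"
  shows "c u \<noteq> c v"
proof
  assume "c u = c v"
  then have "(u, v) \<in> mono_arcs E S c" "(v, u) \<in> mono_arcs E S c"
    using assms by (auto simp: mono_arcs_def)
  then have "(u, u) \<in> (mono_arcs E S c)\<^sup>+" by (meson trancl.intros)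
  then show False using assms(1) by (simp add: dicol_def acyclic_def)
qed

text \<open>
  When all arcs lie in digons, dicolourings are proper colourings of the underlying graph.
\<close>

lemma dicol_sym_iff:
  assumes "sym E"
  shows "dicol E k S c \<longleftrightarrow> c ` S \<subseteq> {1..k} \<and> (\<forall>u \<in> S. \<forall>v \<in> S. (u, v) \<in> E \<longrightarrow> c u \<noteq> c v)"
    (is "?L \<longleftrightarrow> ?K \<and> ?P")
proof
  assume ?L
  then have "c u \<noteq> c v" if "u \<in> S" "v \<in> S" "(u, v) \<in> E" for u v
    using dicol_digon[of E k S c u v] that symD[OF assms] by blast
  then show "?K \<and> ?P" using \<open>?L\<close> unfolding dicol_def by blast
next
  assume R: "?K \<and> ?P"
  then have "mono_arcs E S c = {}" by (auto simp: mono_arcs_def)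
  then show ?L using R by (simp add: dicol_def acyclic_def)
qed

lemma dicol_restrict: "S \<subseteq> W \<Longrightarrow> dicol (E \<inter> W \<times> W) k S c \<longleftrightarrow> dicol E k S c"
proof -
  assume "S \<subseteq> W"
  then have "mono_arcs (E \<inter> W \<times> W) S c = mono_arcs E S c" by (auto simp: mono_arcs_def)
  then show ?thesis by (simp add: dicol_def)
qed

section \<open>Vertex-critical digraphs\<close>

text \<open>
  Criticality refers to deleting vertices only, which is what a minimal non-dicolourable set of vertices
  provides. This locale and the regular one below are closed under reversing all arcs, so facts about out-neighbours transfer to
  in-neighbours.
\<close>

locale vertex_critical =
  fixes V :: "'a set" and E :: "('a \<times> 'a) set" and k :: nat
  assumes finite_V: "finite V"
    and arcs_in: "E \<subseteq> V \<times> V"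
    and loopfree: "(v, v) \<notin> E"
    and not_dicol: "\<not> dicol E k V c"
    and proper_dicol: "S \<subset> V \<Longrightarrow> \<exists>c. dicol E k S c"
begin

lemma converse_critical: "vertex_critical V (E\<inverse>) k"
proof unfold_locales
  show "E\<inverse> \<subseteq> V \<times> V" using arcs_in by blast
qed (simp_all add: finite_V loopfree not_dicol proper_dicol dicol_converse)

lemma finite_out: "finite (E `` {v})"
  by (rule finite_subset[OF _ finite_V]) (use arcs_in in blast)

text \<open>
  A colour missing among the out-neighbours of the only uncoloured vertex \<open>v\<close> could be given to \<open>v\<close>.
\<close>

lemma hole_out_colours:
  assumes "v \<in> V" "dicol E k (V - {v}) c"
  shows "{1..k} \<subseteq> c ` (E `` {v})"
proof
  fix i assume i: "i \<in> {1..k}"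
  show "i \<in> c ` (E `` {v})"
  proof (rule ccontr)
    assume "i \<notin> c ` (E `` {v})"
    then have "dicol E k (insert v (V - {v})) (c(v := i))"
      using assms i loopfree by (intro dicol_insert_out) auto
    then show False using not_dicol assms(1) by (simp add: insert_absorb)
  qed
qed

lemma out_degree_ge:
  assumes "v \<in> V"
  shows "k \<le> card (E `` {v})"
proof -
  from assms obtain c where "dicol E k (V - {v}) c" using proper_dicol[of "V - {v}"] by blast
  from card_mono[OF _ hole_out_colours[OF assms this]] have "k \<le> card (c ` (E `` {v}))"
    using finite_out by simp
  also have "\<dots> \<le> card (E `` {v})" by (rule card_image_le[OF finite_out])
  finally show ?thesis .
qed

lemma in_degree_ge: "v \<in> V \<Longrightarrow> k \<le> card (E\<inverse> `` {v})"
  by (rule vertex_critical.out_degree_ge[OF converse_critical])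

text \<open>
  Otherwise the two sides of a one-way cut could be dicoloured independently. Connectivity is phrased with
  cuts here and below, because the greedy colouring only ever asks for an arc that leaves a given set.
\<close>

lemma strongly_connected:
  assumes "T \<subset> V" "T \<noteq> {}"
  shows "\<exists>a \<in> T. \<exists>b \<in> V - T. (a, b) \<in> E"
proof (rule ccontr)
  assume no: "\<not> ?thesis"
  obtain c1 where c1: "dicol E k T c1" using proper_dicol assms by blast
  obtain c2 where c2: "dicol E k (V - T) c2" using proper_dicol[of "V - T"] assms by blast
  let ?c = "\<lambda>v. if v \<in> T then c1 v else c2 v"
  have "dicol E k T ?c" using c1 by (subst dicol_cong[of _ _ c1]) auto
  moreover have "dicol E k (V - T) ?c" using c2 by (subst dicol_cong[of _ _ c2]) auto
  ultimately have "dicol E k ((V - T) \<union> T) ?c"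
    by (intro dicol_Un) (use no in auto)
  then show False using not_dicol assms by (simp add: Un_absorb2 psubset_imp_subset)
qed

end

lemma exists_vertex_critical:
  assumes "finite V" "\<And>v. (v, v) \<notin> E" "\<And>c. \<not> dicol E k V c"
  shows "\<exists>W \<subseteq> V. vertex_critical W (E \<inter> W \<times> W) k"
proof -
  define \<A> where "\<A> = {W \<in> Pow V. \<forall>c. \<not> dicol E k W c}"
  have "finite \<A>" "\<A> \<noteq> {}" using assms by (auto simp: \<A>_def)
  then obtain W where W: "W \<in> \<A>" and min: "\<And>W'. W' \<in> \<A> \<Longrightarrow> W' \<subseteq> W \<Longrightarrow> W = W'"
    using finite_has_minimal[of \<A>] by blast
  have "vertex_critical W (E \<inter> W \<times> W) k"
  proof
    show "finite W" using W assms(1) by (auto simp: \<A>_def intro: finite_subset)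
    show "\<not> dicol (E \<inter> W \<times> W) k W c" for c using W by (simp add: \<A>_def dicol_restrict)
    show "\<exists>c. dicol (E \<inter> W \<times> W) k S c" if "S \<subset> W" for S
    proof -
      have "S \<notin> \<A>" using min[of S] that by blast
      then have "\<exists>c. dicol E k S c" using that W by (auto simp: \<A>_def)
      then show ?thesis using that by (auto simp: dicol_restrict)
    qed
  qed (use assms(2) in auto)
  then show ?thesis using W by (auto simp: \<A>_def)
qed

section \<open>Regular critical digraphs\<close>

lemma card_arcs_from:
  assumes "finite R" "\<And>v. finite (E `` {v})"
  shows "card (E \<inter> R \<times> UNIV) = (\<Sum>v\<in>R. card (E `` {v}))"
proof -
  have "E \<inter> R \<times> UNIV = (SIGMA v:R. E `` {v})" by auto
  then show ?thesis using assms by simp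
qed

lemma card_arcs_to:
  assumes "finite R" "\<And>v. finite (E\<inverse> `` {v})"
  shows "card (E \<inter> UNIV \<times> R) = (\<Sum>v\<in>R. card (E\<inverse> `` {v}))"
proof -
  have "E \<inter> UNIV \<times> R = (E\<inverse> \<inter> R \<times> UNIV)\<inverse>" by auto
  then show ?thesis using card_arcs_from[of R "E\<inverse>"] assms by (simp only: card_inverse)
qed

locale regular_critical = vertex_critical +
  assumes out_degree: "v \<in> V \<Longrightarrow> card (E `` {v}) = k"
    and in_degree: "v \<in> V \<Longrightarrow> card (E\<inverse> `` {v}) = k"
begin

lemma converse_regular_critical: "regular_critical V (E\<inverse>) k"
  using converse_critical out_degree in_degree
  by (simp add: regular_critical_def regular_critical_axioms_def)

lemma finite_in: "finite (E\<inverse> `` {v})"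
  by (rule vertex_critical.finite_out[OF converse_critical])

text \<open>
  The \<open>k\<close> out-neighbours of the uncoloured vertex show all \<open>k\<close> colours, hence each of them exactly once. The
  contradictions below come from colourings in which two out-neighbours share a colour.
\<close>

lemma hole_out_inj:
  assumes "v \<in> V" "dicol E k (V - {v}) c"
  shows "inj_on c (E `` {v})"
proof -
  have "k \<le> card (c ` (E `` {v}))"
    using card_mono[OF _ hole_out_colours[OF assms]] finite_out by simp
  then show ?thesis
    using out_degree[OF assms(1)] card_image_le[OF finite_out[of v], of c]
    by (intro eq_card_imp_inj_on finite_out) simp
qed

text \<open>
  The uncoloured vertices are coloured one after another, finishing close to \<open>z\<close>: a vertex with an in-neighbour
  that is still uncoloured sees at most \<open>k - 1\<close> colours among its in-neighbours, so it can get a colour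
  that differs from all of them. In particular, no vertex of \<open>P\<close> acquires a monochromatic arc to a newly
  coloured vertex; this last conclusion is what the proof of symmetry uses.
\<close>

lemma greedy_extension:
  assumes z: "z \<in> V - P" and "P \<subseteq> V" and c: "dicol E k P c"
    and cut: "\<And>T. z \<in> T \<Longrightarrow> T \<subset> V - P \<Longrightarrow> \<exists>a \<in> T. \<exists>b \<in> V - P - T. (a, b) \<in> E"
  shows "\<exists>c'. dicol E k (V - {z}) c' \<and> (\<forall>u \<in> P. c' u = c u)
    \<and> (\<forall>u \<in> P. \<forall>v \<in> V - P - {z}. (u, v) \<in> E \<longrightarrow> c' u \<noteq> c' v)"
proof -
  define ok where "ok T c' \<longleftrightarrow> dicol E k (V - T) c' \<and> (\<forall>u \<in> P. c' u = c u)
    \<and> (\<forall>u \<in> P. \<forall>v \<in> V - P - T. (u, v) \<in> E \<longrightarrow> c' u \<noteq> c' v)" for T c'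
  \<comment> \<open>The order of colouring is built backwards: \<open>T\<close> is the set still to be coloured, and it grows
    from \<open>{z}\<close> along arcs to all of \<open>V - P\<close>.\<close>
  define Q where "Q T \<longleftrightarrow> ((\<exists>c'. ok T c') \<longrightarrow> (\<exists>c'. ok {z} c'))" for T
  define \<A> where "\<A> = {T. z \<in> T \<and> T \<subseteq> V - P \<and> Q T}"
  have "finite \<A>" using finite_V by (auto simp: \<A>_def intro: finite_subset[of _ "Pow V"])
  moreover have "{z} \<in> \<A>" using z by (auto simp: \<A>_def Q_def)
  ultimately obtain T where T: "T \<in> \<A>" and max: "\<And>T'. T' \<in> \<A> \<Longrightarrow> T \<subseteq> T' \<Longrightarrow> T = T'"
    using finite_has_maximal[of \<A>] by blast
  have "T = V - P"
  proof (rule ccontr)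
    assume "T \<noteq> V - P"
    then obtain a b where ab: "a \<in> T" "b \<in> V - P - T" "(a, b) \<in> E"
      using cut[of T] T by (auto simp: \<A>_def)
    have "Q (insert b T)" unfolding Q_def
    proof
      assume "\<exists>c'. ok (insert b T) c'"
      then obtain c' where c': "ok (insert b T) c'" ..
      let ?N = "E\<inverse> `` {b} - {a}"
      have "card (c' ` ?N) \<le> card ?N" by (rule card_image_le) (use finite_in in blast)
      also have "\<dots> < card (E\<inverse> `` {b})"
        using ab finite_in by (intro psubset_card_mono) auto
      also have "\<dots> = k" using ab in_degree by blast
      finally have "\<not> {1..k} \<subseteq> c' ` ?N"
        using card_mono[of "c' ` ?N" "{1..k}"] finite_in by (metis card_atLeastAtMost
          diff_Suc_1 finite_Diff finite_imageI not_less)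
      then obtain i where i: "i \<in> {1..k}" "i \<notin> c' ` ?N" by blast
      have fresh: "c' u \<noteq> i" if "u \<in> V - T" "(u, b) \<in> E" for u
        using i(2) that ab(1) by blast
      have "dicol E k (insert b (V - insert b T)) (c'(b := i))"
        using c' i(1) fresh loopfree by (intro dicol_insert_in) (auto simp: ok_def)
      moreover have "insert b (V - insert b T) = V - T" using ab by blast
      ultimately have "dicol E k (V - T) (c'(b := i))" by simp
      moreover have "b \<notin> P" "P \<subseteq> V - T" using ab(2) T assms(2) by (auto simp: \<A>_def)
      ultimately have "ok T (c'(b := i))"
        using c' fresh unfolding ok_def by auto
      then show "\<exists>c'. ok {z} c'" using T by (auto simp: \<A>_def Q_def)
    qed
    then have "insert b T \<in> \<A>" using T ab by (auto simp: \<A>_def)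
    then show False using max ab by blast
  qed
  moreover have "ok (V - P) c"
    using c \<open>P \<subseteq> V\<close> by (simp add: ok_def double_diff)
  ultimately have "\<exists>c'. ok {z} c'" using T by (auto simp: \<A>_def Q_def)
  then show ?thesis by (simp add: ok_def)
qed

section \<open>Symmetry of regular critical digraphs\<close>

text \<open>
  Some out-neighbour of the uncoloured vertex \<open>x\<close> lies in \<open>R\<close>, since \<open>R\<close> can only be entered from \<open>x\<close>. If another
  one lay in \<open>T\<close>, exchanging the colours of the two inside \<open>R\<close> alone would give them the same colour.
\<close>

lemma hole_cut_out:
  assumes x: "x \<in> V" and c: "dicol E k (V - {x}) c"
    and part: "R \<union> T = V - {x}" "R \<inter> T = {}" "R \<noteq> {}"
    and cut: "\<And>a b. (a, b) \<in> E \<Longrightarrow> a \<in> T \<Longrightarrow> b \<notin> R"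
  shows "E `` {x} \<subseteq> R"
proof
  fix b' assume b': "b' \<in> E `` {x}"
  have "V - R \<subset> V" "V - R \<noteq> {}" using part x by auto
  from strongly_connected[OF this] obtain a b where "a \<in> V - R" "b \<in> V - (V - R)" "(a, b) \<in> E"
    by blast
  moreover from this have "a = x" using cut part by blast
  ultimately have b: "(x, b) \<in> E" "b \<in> R" by auto
  show "b' \<in> R"
  proof (rule ccontr)
    assume nb': "b' \<notin> R"
    have "b' \<in> V - {x}" "b \<in> V - {x}" using b' b arcs_in loopfree part by auto
    then have col: "c b \<in> {1..k}" "c b' \<in> {1..k}" using c unfolding dicol_def by blast+
    let ?c = "\<lambda>v. if v \<in> R then transpose (c b) (c b') (c v) else c v"
    have "dicol E k (R \<union> T) ?c"
      using part cut col by (intro dicol_recolour_part dicol_subset[OF c]) auto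
    then have "inj_on ?c (E `` {x})" using hole_out_inj[OF x] part by simp
    moreover have "?c b = ?c b'" using b nb' by simp
    ultimately have "b = b'" using inj_onD[of ?c "E `` {x}" b b'] b(1) b' by blast
    then show False using b(2) nb' by simp
  qed
qed

text \<open>
  Giving the colour \<open>i\<close> to \<open>x\<close> creates a monochromatic cycle, which goes from \<open>x\<close> into \<open>R\<close> and comes back from
  \<open>T\<close>, so it crosses the cut.
\<close>

lemma hole_crossing_arc:
  assumes x: "x \<in> V" and c: "dicol E k (V - {x}) c"
    and part: "R \<union> T = V - {x}" "R \<inter> T = {}"
    and out: "E `` {x} \<subseteq> R" and inn: "E\<inverse> `` {x} \<subseteq> T" and i: "i \<in> {1..k}"
  shows "\<exists>a \<in> R. \<exists>b \<in> T. (a, b) \<in> E \<and> c a = i \<and> c b = i"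
proof (rule ccontr)
  assume no: "\<not> ?thesis"
  let ?c = "c(x := i)" and ?A = "{u \<in> R. c u = i}"
  have xR: "x \<notin> R" using part by blast
  have "dicol E k (insert x ?A) ?c"
    using i loopfree part xR inn by (intro dicol_insert_in dicol_subset[OF c]) auto
  moreover have "dicol E k (V - insert x ?A) ?c"
    using dicol_subset[OF c, of "V - insert x ?A"] by (subst dicol_cong[of _ _ c]) auto
  ultimately have "dicol E k ((V - insert x ?A) \<union> insert x ?A) ?c"
  proof (intro dicol_Un)
    fix u v assume uv: "(u, v) \<in> E" "u \<in> insert x ?A - (V - insert x ?A)" "v \<in> V - insert x ?A"
    then have "v \<in> R \<Longrightarrow> c v \<noteq> i" by blast
    moreover have "v \<in> T \<Longrightarrow> c v \<noteq> i" using uv no out part by auto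
    moreover have "v \<in> R \<or> v \<in> T" "v \<noteq> x" using uv(3) part(1) by blast+
    moreover have "?c u = i" using uv(2) by auto
    ultimately show "?c u \<noteq> ?c v" by auto
  qed
  moreover have "(V - insert x ?A) \<union> insert x ?A = V" using x part by blast
  ultimately show False using not_dicol by simp
qed

text \<open>
  Balance at \<open>R\<close>: by regularity as many arcs leave \<open>R\<close> as enter it, and the entering ones are the \<open>k\<close> arcs from
  \<open>x\<close>. The leaving ones all end in \<open>T\<close>.
\<close>

lemma card_crossing_arcs:
  assumes x: "x \<in> V"
    and part: "R \<union> T = V - {x}" "R \<inter> T = {}"
    and cut: "\<And>a b. (a, b) \<in> E \<Longrightarrow> a \<in> T \<Longrightarrow> b \<notin> R"
    and out: "E `` {x} \<subseteq> R" and inn: "E\<inverse> `` {x} \<subseteq> T"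
  shows "card (E \<inter> R \<times> T) = k"
proof -
  have fin: "finite R" "finite T" "finite E"
    using part finite_V finite_subset[OF arcs_in] by (auto intro: finite_subset[of _ V])
  have RV: "R \<subseteq> V" and xRT: "x \<notin> R" "x \<notin> T" using part by blast+
  have "E \<inter> R \<times> UNIV = E \<inter> R \<times> R \<union> E \<inter> R \<times> T"
  proof
    show "E \<inter> R \<times> UNIV \<subseteq> E \<inter> R \<times> R \<union> E \<inter> R \<times> T"
      using arcs_in part inn by blast
  qed blast
  then have "card (E \<inter> R \<times> UNIV) = card (E \<inter> R \<times> R) + card (E \<inter> R \<times> T)"
    using fin part(2) by (simp add: card_Un_disjoint disjoint_iff)
  moreover have "E \<inter> UNIV \<times> R = E \<inter> R \<times> R \<union> {x} \<times> (E `` {x})"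
  proof
    show "E \<inter> UNIV \<times> R \<subseteq> E \<inter> R \<times> R \<union> {x} \<times> (E `` {x})"
      using arcs_in part cut by blast
    show "E \<inter> R \<times> R \<union> {x} \<times> (E `` {x}) \<subseteq> E \<inter> UNIV \<times> R"
      using out by blast
  qed
  then have "card (E \<inter> UNIV \<times> R) = card (E \<inter> R \<times> R) + k"
    using fin finite_out xRT out_degree[OF x]
    by (simp add: card_Un_disjoint disjoint_iff card_cartesian_product)
  moreover have "card (E \<inter> R \<times> UNIV) = card (E \<inter> UNIV \<times> R)"
    using RV fin finite_out finite_in out_degree in_degree
    by (simp add: card_arcs_from card_arcs_to subset_iff)
  ultimately show ?thesis by simp
qed

text \<open>
  Suppose that all arcs between \<open>R = V - {x} - T\<close> and \<open>T\<close> go from \<open>R\<close> to \<open>T\<close>. There are exactly \<open>k\<close> of them, and each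
  of the \<open>k\<close> colours needs a monochromatic one, so all of them are monochromatic. After exchanging the
  colours 1 and 2 on \<open>R\<close>, none is monochromatic in colour 1, which is a contradiction. The second colour is where
  \<open>k \<ge> 2\<close> enters; a directed cycle of length at least 3 shows that the claim fails for \<open>k = 1\<close>.
\<close>

lemma strongly_connected_minus_vertex:
  assumes k: "2 \<le> k" and x: "x \<in> V" and T: "T \<noteq> {}" "T \<subset> V - {x}"
  shows "\<exists>a \<in> T. \<exists>b \<in> V - {x} - T. (a, b) \<in> E"
proof (rule ccontr)
  assume no: "\<not> ?thesis"
  define R where "R = V - {x} - T"
  have part: "R \<union> T = V - {x}" "R \<inter> T = {}" "R \<noteq> {}" using T by (auto simp: R_def)
  have cut: "b \<notin> R" if "(a, b) \<in> E" "a \<in> T" for a b using no that by (auto simp: R_def)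
  obtain c where c: "dicol E k (V - {x}) c" using proper_dicol[of "V - {x}"] x by blast
  have out: "E `` {x} \<subseteq> R" by (rule hole_cut_out[OF x c part cut])
  interpret conv: regular_critical V "E\<inverse>" k by (rule converse_regular_critical)
  have "dicol (E\<inverse>) k (V - {x}) c" using c by (simp add: dicol_converse)
  from conv.hole_cut_out[OF x this, of T R] have inn: "E\<inverse> `` {x} \<subseteq> T"
    using part T cut by (auto simp: Un_commute Int_commute)
  let ?F = "E \<inter> R \<times> T" and ?M = "{(a, b) \<in> E \<inter> R \<times> T. c a = c b}"
  have finF: "finite ?F" by (rule finite_subset[of _ "V \<times> V"]) (use arcs_in finite_V in auto)
  have "{1..k} \<subseteq> (c \<circ> fst) ` ?M"
  proof
    fix i assume "i \<in> {1..k}"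
    from hole_crossing_arc[OF x c part(1,2) out inn this] obtain a b
      where "a \<in> R" "b \<in> T" "(a, b) \<in> E" "c a = i" "c b = i" by blast
    then show "i \<in> (c \<circ> fst) ` ?M" by (intro image_eqI[of _ _ "(a, b)"]) simp_all
  qed
  then have "k \<le> card ((c \<circ> fst) ` ?M)"
    using card_mono[of "(c \<circ> fst) ` ?M" "{1..k}"] finite_subset[OF _ finF, of ?M] by force
  also have "\<dots> \<le> card ?M" by (rule card_image_le, rule finite_subset[OF _ finF]) blast
  finally have "card ?F \<le> card ?M"
    using card_crossing_arcs[OF x part(1,2) cut out inn] by simp
  then have all_mono: "?M = ?F" by (intro card_seteq finF) auto
  have "dicol E k (R \<union> T) (\<lambda>v. if v \<in> R then transpose 1 2 (c v) else c v)" (is "dicol _ _ _ ?c")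
    using part cut k by (intro dicol_recolour_part dicol_subset[OF c]) auto
  then have "dicol E k (V - {x}) ?c" using part by simp
  from hole_crossing_arc[OF x this part(1,2) out inn, of 1] k
  obtain a b where ab: "a \<in> R" "b \<in> T" "(a, b) \<in> E" "?c a = 1" "?c b = 1" by auto
  then have "b \<notin> R" "(a, b) \<in> ?M" using part(2) all_mono by blast+
  then have "c a = c b" "c b = 1" using ab(5) by simp_all
  then have "?c a = 2" using ab(1) by simp
  then show False using ab(4) by simp
qed

text \<open>
  Suppose that \<open>w \<rightarrow> x\<close> has no reverse arc. Colour \<open>x\<close> first and then everything except \<open>w\<close> greedily, so that no
  monochromatic arc leaves \<open>x\<close>. Now give \<open>w\<close> the colour of \<open>x\<close>. The only out-neighbour of \<open>w\<close> with that colour is \<open>x\<close>,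
  where every monochromatic walk ends, so this dicolours all of \<open>V\<close>.
\<close>

lemma arcs_symmetric:
  assumes k: "2 \<le> k" and wx: "(w, x) \<in> E"
  shows "(x, w) \<in> E"
proof (rule ccontr)
  assume nxw: "(x, w) \<notin> E"
  have V: "w \<in> V" "x \<in> V" and "w \<noteq> x" using wx arcs_in loopfree by auto
  have "dicol E k {x} (\<lambda>_. 1)"
    using k loopfree[of x] by (auto simp: dicol_def mono_arcs_def acyclic_def dest!: tranclD)
  moreover have "\<exists>a \<in> T. \<exists>b \<in> V - {x} - T. (a, b) \<in> E" if "w \<in> T" "T \<subset> V - {x}" for T
    using strongly_connected_minus_vertex[OF k V(2) _ that(2)] that(1) by blast
  ultimately obtain c where c: "dicol E k (V - {w}) c"
    and fresh: "\<And>v. v \<in> V - {x} - {w} \<Longrightarrow> (x, v) \<in> E \<Longrightarrow> c x \<noteq> c v"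
    using greedy_extension[of w "{x}" "\<lambda>_. 1"] V \<open>w \<noteq> x\<close> by auto
  have i: "c x \<in> {1..k}" using c V \<open>w \<noteq> x\<close> unfolding dicol_def by blast
  have "c u \<noteq> c x" if "u \<in> V - {w, x}" "(w, u) \<in> E" for u
    using inj_onD[OF hole_out_inj[OF V(1) c], of u x] that wx by auto
  \<comment> \<open>The sink \<open>x\<close> is taken out and put back after \<open>w\<close>, so that both insertions have a free colour.\<close>
  then have "dicol E k (insert w (V - {w, x})) (c(w := c x))"
    using i loopfree by (intro dicol_insert_out dicol_subset[OF c]) auto
  then have "dicol E k (insert x (insert w (V - {w, x}))) (c(w := c x, x := c x))"
  proof (rule dicol_insert_out)
    fix u assume "u \<in> insert w (V - {w, x})" "(x, u) \<in> E"
    then have "u \<in> V - {x} - {w}" using nxw by blast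
    then show "(c(w := c x)) u \<noteq> c x" using fresh[of u] \<open>(x, u) \<in> E\<close> by auto
  qed (use i loopfree \<open>w \<noteq> x\<close> in auto)
  moreover have "insert x (insert w (V - {w, x})) = V" using V by blast
  ultimately show False using not_dicol by simp
qed

end

section \<open>Completeness of symmetric regular critical digraphs\<close>

locale symmetric_critical = regular_critical +
  assumes symmetric: "sym E" and k: "3 \<le> k"
begin

lemmas proper_iff = dicol_sym_iff[OF symmetric]

text \<open>
  Two colourings that agree on whether \<open>u\<close> and \<open>w\<close> have the same colour can be made equal on \<open>{u, w}\<close> by
  permuting colours, and then combine to a colouring of \<open>V\<close>.
\<close>

lemma glue_at_pair:
  assumes uw: "u \<noteq> w" "(u, w) \<notin> E"
    and part: "V = R \<union> T \<union> {u, w}" "R \<inter> (T \<union> {u, w}) = {}" "T \<inter> {u, w} = {}"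
    and sep: "E \<inter> R \<times> T = {}"
    and c: "dicol E k (R \<union> {u, w}) c" and d: "dicol E k (T \<union> {u, w}) d"
  shows "c u = c w \<longleftrightarrow> d u \<noteq> d w"
proof (rule ccontr)
  assume "\<not> ?thesis"
  then have same: "c u = c w \<longleftrightarrow> d u = d w" by blast
  have colours: "c u \<in> {1..k}" "c w \<in> {1..k}" "d u \<in> {1..k}" "d w \<in> {1..k}"
    using c d unfolding dicol_def by blast+
  \<comment> \<open>The inner transposition corrects the colour of \<open>u\<close>. The outer one corrects that of \<open>w\<close>; it keeps
    \<open>u\<close> fixed because of the agreement between \<open>c\<close> and \<open>d\<close>.\<close>
  define \<pi> where "\<pi> = transpose (transpose (d u) (c u) (d w)) (c w) \<circ> transpose (d u) (c u)"
  have "transpose (d u) (c u) (d w) \<in> {1..k}" using colours by (simp add: transpose_def)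
  then have "dicol E k (T \<union> {u, w}) (\<pi> \<circ> d)"
    unfolding \<pi>_def comp_assoc by (intro dicol_transpose d colours)
  moreover have "(\<pi> \<circ> d) u = c u" "(\<pi> \<circ> d) w = c w"
    using same by (auto simp: \<pi>_def transpose_def)
  ultimately obtain d' where d': "dicol E k (T \<union> {u, w}) d'" "d' u = c u" "d' w = c w" by blast
  let ?c = "\<lambda>v. if v \<in> T then d' v else c v"
  have "dicol E k V ?c" unfolding proper_iff
  proof (intro conjI ballI impI)
    show "?c ` V \<subseteq> {1..k}" using c d' part unfolding dicol_def by auto
  next
    fix a b assume ab: "a \<in> V" "b \<in> V" "(a, b) \<in> E"
    have A: "c a \<noteq> c b" if "a \<in> R \<union> {u, w}" "b \<in> R \<union> {u, w}"
      using c ab(3) that unfolding proper_iff by blast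
    have B: "d' a \<noteq> d' b" if "a \<in> T \<union> {u, w}" "b \<in> T \<union> {u, w}"
      using d'(1) ab(3) that unfolding proper_iff by blast
    have "(b, a) \<in> E" using ab(3) symmetric by (auto dest: symD)
    then have "\<not> (a \<in> R \<and> b \<in> T)" "\<not> (a \<in> T \<and> b \<in> R)" using sep ab(3) by auto
    then show "?c a \<noteq> ?c b" using A B ab d'(2,3) part by (auto split: if_splits)
  qed
  then show False using not_dicol by blast
qed

text \<open>
  By gluing, \<open>u\<close> and \<open>w\<close> have the same colour in every colouring of the side of \<open>R\<close>. Hence neither of them can be
  recoloured there, so each has \<open>k - 1\<close> neighbours in \<open>R\<close> and at most one in \<open>T\<close>. These at most two
  neighbours in \<open>T\<close> leave one of the \<open>k \<ge> 3\<close> colours free for both \<open>u\<close> and \<open>w\<close> on the side of \<open>T\<close>, where they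
  must differ.
\<close>

lemma no_mixed_nonadjacent_separation:
  assumes uw: "u \<noteq> w" "(u, w) \<notin> E"
    and part: "V = R \<union> T \<union> {u, w}" "R \<inter> (T \<union> {u, w}) = {}" "T \<inter> {u, w} = {}"
    and sep: "E \<inter> R \<times> T = {}"
    and c: "dicol E k (R \<union> {u, w}) c" "c u = c w"
    and d: "dicol E k (T \<union> {u, w}) d" "d u \<noteq> d w"
  shows False
proof -
  note glue = glue_at_pair[OF uw part sep]
  have wu: "(w, u) \<notin> E" using uw symmetric by (auto dest: symD)
  have few: "card (E `` {y} \<inter> T) \<le> 1" if y: "y \<in> {u, w}" for y
  proof -
    have "{1..k} - {c y} \<subseteq> c ` (E `` {y} \<inter> R)"
    proof (rule ccontr)
      assume "\<not> ?thesis"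
      then obtain j where j: "j \<in> {1..k}" "j \<noteq> c y" "j \<notin> c ` (E `` {y} \<inter> R)" by blast
      let ?S = "R \<union> {u, w} - {y}"
      have "dicol E k (insert y ?S) (c(y := j))"
      proof (rule dicol_insert_out)
        fix v assume "v \<in> ?S" "(y, v) \<in> E"
        then have "v \<in> R" using y uw wu by blast
        then show "c v \<noteq> j" using j \<open>(y, v) \<in> E\<close> by blast
      qed (use j loopfree dicol_subset[OF c(1)] in auto)
      moreover have "insert y ?S = R \<union> {u, w}" using y by blast
      ultimately have "dicol E k (R \<union> {u, w}) (c(y := j))" by simp
      from glue[OF this d(1)] d(2) have "(c(y := j)) u = (c(y := j)) w" by simp
      then show False using y j(2) c(2) uw(1) by (auto split: if_splits)
    qed
    then have "card ({1..k} - {c y}) \<le> card (c ` (E `` {y} \<inter> R))"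
      using finite_out by (intro card_mono) auto
    also have "\<dots> \<le> card (E `` {y} \<inter> R)" using finite_out by (intro card_image_le) auto
    finally have "k \<le> Suc (card (E `` {y} \<inter> R))"
      by (metis One_nat_def Suc_le_mono Suc_pred card_Diff_singleton_if card_atLeastAtMost
        diff_Suc_1 le_SucI not0_implies_Suc le0)
    moreover have "card (E `` {y} \<inter> R) + card (E `` {y} \<inter> T) = card ((E `` {y} \<inter> R) \<union> (E `` {y} \<inter> T))"
      using finite_out part by (intro card_Un_disjoint[symmetric]) auto
    moreover have "card ((E `` {y} \<inter> R) \<union> (E `` {y} \<inter> T)) \<le> card (E `` {y})"
      using finite_out by (intro card_mono) auto
    moreover have "card (E `` {y}) = k" using y part by (intro out_degree) blast
    ultimately show ?thesis by linarith
  qed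
  let ?F = "d ` (E `` {u} \<inter> T) \<union> d ` (E `` {w} \<inter> T)"
  have "card ?F \<le> card (d ` (E `` {u} \<inter> T)) + card (d ` (E `` {w} \<inter> T))" by (rule card_Un_le)
  also have "\<dots> \<le> card (E `` {u} \<inter> T) + card (E `` {w} \<inter> T)"
    using finite_out by (intro add_mono card_image_le) auto
  also have "\<dots> < k" using few[of u] few[of w] k by simp
  finally have "\<not> {1..k} \<subseteq> ?F"
    using card_mono[of ?F "{1..k}"] finite_out by auto
  then obtain j where j: "j \<in> {1..k}" "j \<notin> ?F" by blast
  have "dicol E k (insert u T) (d(u := j))"
    using j loopfree part by (intro dicol_insert_out dicol_subset[OF d(1)]) auto
  then have "dicol E k (insert w (insert u T)) (d(u := j, w := j))"
  proof (rule dicol_insert_out)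
    fix v assume "v \<in> insert u T" "(w, v) \<in> E"
    then show "(d(u := j)) v \<noteq> j" using wu j(2) part(3) by auto
  qed (use j loopfree part uw in auto)
  then have "dicol E k (T \<union> {u, w}) (d(u := j, w := j))" by (simp add: insert_commute)
  from glue[OF c(1) this] c(2) uw(1) show False by simp
qed

text \<open>
  If \<open>u\<close> and \<open>w\<close> separated \<open>V\<close>, both sides together with \<open>u\<close> and \<open>w\<close> could be coloured by criticality. By gluing,
  exactly one of the two colourings gives \<open>u\<close> and \<open>w\<close> the same colour, and that is impossible.
\<close>

lemma connected_minus_nonadjacent_pair:
  assumes uw: "u \<in> V" "w \<in> V" "u \<noteq> w" "(u, w) \<notin> E" and T: "T \<noteq> {}" "T \<subset> V - {u, w}"
  shows "\<exists>a \<in> T. \<exists>b \<in> V - {u, w} - T. (a, b) \<in> E"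
proof (rule ccontr)
  assume no: "\<not> ?thesis"
  define R where "R = V - {u, w} - T"
  have part: "V = R \<union> T \<union> {u, w}" "R \<inter> (T \<union> {u, w}) = {}" "T \<inter> {u, w} = {}"
    using T uw by (auto simp: R_def)
  then have part': "V = T \<union> R \<union> {u, w}" "T \<inter> (R \<union> {u, w}) = {}" "R \<inter> {u, w} = {}" by auto
  have sep': "E \<inter> T \<times> R = {}" using no by (auto simp: R_def)
  then have sep: "E \<inter> R \<times> T = {}" using symmetric by (auto dest: symD)
  have "R \<noteq> {}" using T by (auto simp: R_def)
  then have "R \<union> {u, w} \<subset> V" "T \<union> {u, w} \<subset> V" using T part by blast+
  then obtain c d where c: "dicol E k (R \<union> {u, w}) c" and d: "dicol E k (T \<union> {u, w}) d"
    using proper_dicol by metis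
  show False
  proof (cases "c u = c w")
    case True
    with glue_at_pair[OF uw(3,4) part sep c d] have "d u \<noteq> d w" by simp
    from no_mixed_nonadjacent_separation[OF uw(3,4) part sep c True d this] show False .
  next
    case False
    with glue_at_pair[OF uw(3,4) part sep c d] have "d u = d w" by simp
    from no_mixed_nonadjacent_separation[OF uw(3,4) part' sep' d this c False] show False .
  qed
qed

text \<open>
  Lovasz's argument: nonadjacent neighbours \<open>u\<close> and \<open>w\<close> of \<open>v\<close> get the same colour, and the rest is coloured
  greedily towards \<open>v\<close>, which then sees one colour twice.
\<close>

lemma neighbours_adjacent:
  assumes "(v, u) \<in> E" "(v, w) \<in> E" "u \<noteq> w"
  shows "(u, w) \<in> E"
proof (rule ccontr)
  assume nadj: "(u, w) \<notin> E"
  have V: "u \<in> V" "w \<in> V" "v \<in> V" using assms arcs_in by auto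
  have wu: "(w, u) \<notin> E" using nadj symmetric by (auto dest: symD)
  have "dicol E k {u, w} (\<lambda>_. 1)"
    unfolding proper_iff using k loopfree nadj wu by auto
  moreover have "v \<in> V - {u, w}" using V assms loopfree by auto
  moreover have "\<exists>a \<in> T. \<exists>b \<in> V - {u, w} - T. (a, b) \<in> E" if "v \<in> T" "T \<subset> V - {u, w}" for T
    using connected_minus_nonadjacent_pair[OF V(1,2) assms(3) nadj _ that(2)] that(1) by blast
  ultimately obtain c where c: "dicol E k (V - {v}) c" and "c u = 1" "c w = 1"
    using greedy_extension[of v "{u, w}" "\<lambda>_. 1"] V by auto
  with inj_onD[OF hole_out_inj[OF V(3) c], of u w] assms show False by simp
qed

text \<open>
  The closed neighbourhood of \<open>u\<close> is left by some arc \<open>v \<rightarrow> x\<close>; then \<open>v\<close> has the nonadjacent neighbours \<open>u\<close> and \<open>x\<close>.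
\<close>

lemma complete:
  assumes "u \<in> V" "w \<in> V" "u \<noteq> w"
  shows "(u, w) \<in> E"
proof (rule ccontr)
  assume nadj: "(u, w) \<notin> E"
  let ?T = "insert u (E `` {u})"
  have "?T \<subset> V" using assms nadj arcs_in by auto
  from strongly_connected[OF this] obtain v x
    where vx: "v \<in> ?T" "x \<in> V - ?T" "(v, x) \<in> E" by blast
  then have "(u, v) \<in> E" by blast
  then have "(v, u) \<in> E" using symmetric by (auto dest: symD)
  then show False using neighbours_adjacent[of v u x] vx by blast
qed

lemma card_V: "card V = k + 1"
proof -
  have "V \<noteq> {}" using not_dicol by (auto simp: dicol_def mono_arcs_def acyclic_def)
  then obtain v where v: "v \<in> V" by blast
  have "V = insert v (E `` {v})" using v complete arcs_in by blast
  then have "card V = Suc (card (E `` {v}))"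
    using finite_out loopfree by (metis Image_singleton_iff card_insert_disjoint)
  then show ?thesis using out_degree[OF v] by simp
qed

end

section \<open>Reduction to regular critical digraphs\<close>

text \<open>
  The first set drops the arcs that enter \<open>X\<close>; the second one completes the arcs that leave \<open>X\<close> to digons.
  The out-neighbours of a vertex in \<open>X\<close> and the in-neighbours of a vertex outside \<open>X\<close> are the same as before.
\<close>

definition digonify :: "'a set \<Rightarrow> ('a \<times> 'a) set \<Rightarrow> ('a \<times> 'a) set" where
  "digonify X E = {(u, v) \<in> E. v \<in> X \<longrightarrow> u \<in> X} \<union> {(v, u) | u v. (u, v) \<in> E \<and> u \<in> X \<and> v \<notin> X}"

text \<open>
  No arc that leaves \<open>X\<close> is monochromatic, since its ends form a digon in the new digraph. So every monochromatic
  cycle stays in \<open>X\<close> or outside it, where nothing has been changed.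
\<close>

lemma dicol_digonify:
  assumes "dicol (digonify X E) k S c"
  shows "dicol E k S c"
proof -
  have part: "dicol E k S' c" if "S' \<subseteq> S" "S' \<subseteq> X \<or> S' \<inter> X = {}" for S'
  proof -
    have "mono_arcs E S' c \<subseteq> mono_arcs (digonify X E) S c"
      using that by (auto simp: mono_arcs_def digonify_def)
    then have "acyclic (mono_arcs E S' c)"
      using assms acyclic_subset unfolding dicol_def by blast
    then show ?thesis using assms that(1) unfolding dicol_def by blast
  qed
  have "dicol E k ((S - X) \<union> (S \<inter> X)) c"
  proof (intro dicol_Un part)
    fix u v assume "(u, v) \<in> E" "u \<in> S \<inter> X - (S - X)" "v \<in> S - X"
    then show "c u \<noteq> c v" by (intro dicol_digon[OF assms]) (auto simp: digonify_def)
  qed auto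
  moreover have "(S - X) \<union> (S \<inter> X) = S" by blast
  ultimately show ?thesis by simp
qed

text \<open>
  The out-degrees in \<open>A\<close> are \<open>k\<close>. Since as many arcs enter \<open>A\<close> as leave it, the in-degrees have the same sum,
  and none of them is below \<open>k\<close>.
\<close>

lemma (in vertex_critical) in_degree_eq_of_out_degree_le:
  assumes A: "A \<subseteq> V" "\<And>v. v \<in> A \<Longrightarrow> card (E `` {v}) \<le> k"
    and sym: "\<And>u v. u \<in> A \<Longrightarrow> v \<in> V - A \<Longrightarrow> (u, v) \<in> E \<longleftrightarrow> (v, u) \<in> E"
    and v: "v \<in> A"
  shows "card (E\<inverse> `` {v}) = k"
proof -
  interpret conv: vertex_critical V "E\<inverse>" k by (rule converse_critical)
  have fin: "finite A" "finite E"
    using A(1) finite_V finite_subset[OF arcs_in] by (auto intro: finite_subset)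
  have eq: "E \<inter> A \<times> UNIV = E \<inter> A \<times> A \<union> E \<inter> A \<times> (V - A)"
    "E \<inter> UNIV \<times> A = E \<inter> A \<times> A \<union> E \<inter> (V - A) \<times> A"
    using arcs_in by blast+
  have inv: "E \<inter> (V - A) \<times> A = (E \<inter> A \<times> (V - A))\<inverse>"
    using sym by auto
  have "card (E \<inter> UNIV \<times> A) = card (E \<inter> A \<times> A) + card (E \<inter> (V - A) \<times> A)"
    unfolding eq(2) by (rule card_Un_disjoint) (use fin in auto)
  also have "\<dots> = card (E \<inter> A \<times> A) + card (E \<inter> A \<times> (V - A))"
    unfolding inv card_inverse ..
  also have "\<dots> = card (E \<inter> A \<times> UNIV)"
    unfolding eq(1) by (rule card_Un_disjoint[symmetric]) (use fin in auto)
  finally have "(\<Sum>v\<in>A. card (E\<inverse> `` {v})) = (\<Sum>v\<in>A. card (E `` {v}))"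
    using card_arcs_from[OF fin(1) finite_out] card_arcs_to[OF fin(1) conv.finite_out] by simp
  also have "\<dots> = (\<Sum>v\<in>A. k)"
    using A out_degree_ge by (intro sum.cong refl antisym) auto
  finally have "(\<Sum>v\<in>A. k) = (\<Sum>v\<in>A. card (E\<inverse> `` {v}))" ..
  from sum_mono_inv[OF this _ v fin(1)] show ?thesis
    using A(1) in_degree_ge by auto
qed

text \<open>
  The counting argument settles the in-degrees in \<open>X\<close> and, with all arcs reversed, the out-degrees outside \<open>X\<close>.
\<close>

lemma (in vertex_critical) regular_of_partition:
  assumes X: "\<And>v. v \<in> V \<inter> X \<Longrightarrow> card (E `` {v}) \<le> k"
    and Y: "\<And>v. v \<in> V - X \<Longrightarrow> card (E\<inverse> `` {v}) \<le> k"
    and sym: "\<And>u v. u \<in> X \<Longrightarrow> v \<notin> X \<Longrightarrow> (u, v) \<in> E \<longleftrightarrow> (v, u) \<in> E"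
  shows "regular_critical V E k"
proof
  interpret conv: vertex_critical V "E\<inverse>" k by (rule converse_critical)
  fix v assume v: "v \<in> V"
  show "card (E `` {v}) = k"
  proof (cases "v \<in> X")
    case True
    then show ?thesis using X[of v] out_degree_ge[OF v] v by simp
  next
    case False
    have "card ((E\<inverse>)\<inverse> `` {v}) = k"
      by (rule conv.in_degree_eq_of_out_degree_le[of "V - X"]) (use Y sym v False in auto)
    then show ?thesis by simp
  qed
  show "card (E\<inverse> `` {v}) = k"
  proof (cases "v \<in> X")
    case True
    show ?thesis
      by (rule in_degree_eq_of_out_degree_le[of "V \<inter> X"]) (use X sym v True in auto)
  next
    case False
    then show ?thesis using Y[of v] in_degree_ge[OF v] v by simp
  qed
qed

section \<open>Dicolourings, degrees and subdigraphs of a digraph\<close>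

text \<open>
  In the copy of \<open>G\<close> each arc of \<open>G\<close> is represented by an arc of \<open>D\<close> with the corresponding ends; different
  arcs of \<open>G\<close> get different representatives because \<open>f\<close> is injective.
\<close>

lemma contains_pair_digraphI:
  assumes D: "wf_digraph D" and G: "pair_wf_digraph G"
    and f: "inj_on f (pverts G)" "f ` pverts G \<subseteq> verts D"
    and arcs: "\<And>u v. (u, v) \<in> parcs G \<Longrightarrow> (f u, f v) \<in> arcs_ends D"
  shows "contains_subdigraph D (with_proj G)"
proof -
  interpret G: pair_wf_digraph G by (rule G)
  have "\<exists>e. e \<in> arcs D \<and> tail D e = f (fst a) \<and> head D e = f (snd a)" if "a \<in> parcs G" for a
    using arcs[of "fst a" "snd a"] that by (auto simp: arcs_ends_conv)
  then obtain g where g: "\<And>a. a \<in> parcs G \<Longrightarrow>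
      g a \<in> arcs D \<and> tail D (g a) = f (fst a) \<and> head D (g a) = f (snd a)"
    by metis
  define h where "h = \<lparr>iso_verts = f, iso_arcs = g, iso_head = head D, iso_tail = tail D\<rparr>"
  have "inj_on g (parcs G)"
  proof (rule inj_onI)
    fix a b assume ab: "a \<in> parcs G" "b \<in> parcs G" "g a = g b"
    then have "f (fst a) = f (fst b)" "f (snd a) = f (snd b)" using g by metis+
    moreover have "fst a \<in> pverts G" "fst b \<in> pverts G" "snd a \<in> pverts G" "snd b \<in> pverts G"
      using ab G.tail_in_verts G.head_in_verts by auto
    ultimately show "a = b" using f(1) by (meson inj_onD prod.expand)
  qed
  then have iso: "pre_digraph.digraph_isomorphism (with_proj G) h"
    using f(1) g G by (auto simp: wf_digraph_wp_iff pre_digraph.digraph_isomorphism_def h_def)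
  then have "wf_digraph (app_iso h (with_proj G))"
    using G by (intro wf_digraph.wf_digraphI_app_iso) (simp add: wf_digraph_wp_iff)
  then have "subgraph (app_iso h (with_proj G)) D"
    using D f(2) g by (auto simp: subgraph_def compatible_def h_def)
  then show ?thesis using iso unfolding contains_subdigraph_def digraph_iso_def by blast
qed

lemma dicolouring_of_dicol:
  assumes D: "wf_digraph D" and c: "dicol (arcs_ends D) k (verts D) c"
  shows "dicolouring D k c"
  unfolding dicolouring_def
proof (intro conjI ballI notI)
  show "c \<in> verts D \<rightarrow> {1..k}" using c unfolding dicol_def by blast
next
  interpret wf_digraph D by (rule D)
  fix i assume "\<exists>p. pre_digraph.cycle (D \<restriction> {v \<in> verts D. c v = i}) p"
  then obtain p u where p: "pre_digraph.awalk (D \<restriction> {v \<in> verts D. c v = i}) u p u" "p \<noteq> []"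
    by (auto simp: pre_digraph.cycle_def)
  interpret C: wf_digraph "D \<restriction> {v \<in> verts D. c v = i}"
    by (rule wellformed_induce_subgraph)
  have "(u, u) \<in> (arcs_ends (D \<restriction> {v \<in> verts D. c v = i}))\<^sup>+"
    using p C.reachable1_awalk by blast
  moreover have "arcs_ends (D \<restriction> {v \<in> verts D. c v = i}) \<subseteq> mono_arcs (arcs_ends D) (verts D) c"
    by (auto simp: arcs_ends_conv mono_arcs_def)
  ultimately have "(u, u) \<in> (mono_arcs (arcs_ends D) (verts D) c)\<^sup>+"
    by (meson trancl_mono)
  then show False using c by (simp add: dicol_def acyclic_def)
qed

lemma out_degree_eq_card_successors:
  assumes "nomulti_digraph D"
  shows "out_degree D v = card (arcs_ends D `` {v})"
proof -
  interpret nomulti_digraph D by (rule assms)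
  have "inj_on (head D) (out_arcs D v)"
    by (rule inj_onI) (auto intro: no_multi_arcs simp: arc_to_ends_def)
  moreover have "head D ` out_arcs D v = arcs_ends D `` {v}" by (auto simp: arcs_ends_conv)
  ultimately show ?thesis unfolding out_degree_def by (metis card_image)
qed

lemma in_degree_eq_card_predecessors:
  assumes "nomulti_digraph D"
  shows "in_degree D v = card ((arcs_ends D)\<inverse> `` {v})"
proof -
  interpret nomulti_digraph D by (rule assms)
  have "inj_on (tail D) (in_arcs D v)"
    by (rule inj_onI) (auto intro: no_multi_arcs simp: arc_to_ends_def)
  moreover have "tail D ` in_arcs D v = (arcs_ends D)\<inverse> `` {v}" by (auto simp: arcs_ends_conv)
  ultimately show ?thesis unfolding in_degree_def by (metis card_image)
qed

lemma pair_digraph_bidirected_complete: "pair_digraph (bidirected_complete n)"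
proof
  show "finite (parcs (bidirected_complete n))"
    by (rule finite_subset[of _ "{..<n} \<times> {..<n}"]) (auto simp: bidirected_complete_def)
qed (auto simp: bidirected_complete_def)

lemma contains_digonI:
  assumes D: "wf_digraph D" and "u \<noteq> v" "(u, v) \<in> arcs_ends D" "(v, u) \<in> arcs_ends D"
  shows "contains_subdigraph D (with_proj (bidirected_complete 2))"
proof -
  interpret wf_digraph D by (rule D)
  let ?f = "\<lambda>n :: nat. if n = 0 then u else v"
  have verts: "pverts (bidirected_complete 2) = {0, 1}"
    by (auto simp: bidirected_complete_def)
  have arcs: "parcs (bidirected_complete 2) = {(0, 1), (1, 0)}"
    by (auto simp: bidirected_complete_def less_2_cases_iff)
  show ?thesis
  proof (rule contains_pair_digraphI[OF D, where f = ?f])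
    show "pair_wf_digraph (bidirected_complete 2)"
      using pair_digraph_bidirected_complete by (simp add: pair_digraph_def pair_fin_digraph_def)
    show "inj_on ?f (pverts (bidirected_complete 2))"
      unfolding verts using assms(2) by (simp add: inj_on_def)
    show "?f ` pverts (bidirected_complete 2) \<subseteq> verts D"
      unfolding verts using assms(3) by (auto simp: arcs_ends_conv)
    show "(?f a, ?f b) \<in> arcs_ends D" if "(a, b) \<in> parcs (bidirected_complete 2)" for a b
      using that assms(3,4) unfolding arcs by auto
  qed
qed

section \<open>The strengthened directed Brooks theorem\<close>

theorem theorem6:
  fixes D :: "('a, 'b) pre_digraph"
  assumes "digraph D"
    and "\<not> dicolourable D (max_min_degree D)"
  shows "max_min_degree D \<le> 1
    \<or> (max_min_degree D = 2 \<and>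
         contains_subdigraph D (with_proj (bidirected_complete 2)))
    \<or> (max_min_degree D \<ge> 3 \<and>
         (\<exists>r s :: nat. r + s = max_min_degree D + 1 \<and>
            contains_subdigraph D
              (with_proj (directed_join (bidirected_complete r) (bidirected_complete s)))))"
proof (cases "max_min_degree D \<le> 1")
  case False
  interpret digraph D by (rule assms(1))
  define k where "k = max_min_degree D"
  define E where "E = arcs_ends D"
  have k2: "2 \<le> k" using False by (simp add: k_def)
  have E: "E \<subseteq> verts D \<times> verts D" "\<And>v. (v, v) \<notin> E"
    by (auto simp: E_def arcs_ends_conv dest: no_loops)
  have finE: "finite (E `` {v})" "finite (E\<inverse> `` {v})" for v
    by (rule finite_subset[OF _ finite_verts], use E(1) in blast)+
  define X where "X = {v. card (E `` {v}) \<le> k}"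
  have Y: "card (E\<inverse> `` {v}) \<le> k" if "v \<in> verts D" "v \<notin> X" for v
  proof -
    have "min_degree D v \<le> k"
      using that(1) unfolding k_def max_min_degree_def by (intro Max_ge) auto
    then show ?thesis
      using that(2) nomulti_digraph
      by (auto simp: min_degree_def X_def E_def min_def in_degree_eq_card_predecessors
          out_degree_eq_card_successors split: if_splits)
  qed
  have "\<not> dicol (digonify X E) k (verts D) c" for c
    using dicol_digonify dicolouring_of_dicol[OF wf_digraph] assms(2)
    unfolding dicolourable_def k_def E_def by blast
  moreover have "(v, v) \<notin> digonify X E" for v using E(2) by (auto simp: digonify_def)
  ultimately obtain W where W: "W \<subseteq> verts D"
    and crit: "vertex_critical W (digonify X E \<inter> W \<times> W) k"
    using exists_vertex_critical[OF finite_verts] by blast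
  define F where "F = digonify X E \<inter> W \<times> W"
  \<comment> \<open>Only the arcs from the complement of \<open>X\<close> into \<open>X\<close> may be new.\<close>
  have F_in_E: "(u, v) \<in> E" if "(u, v) \<in> F" "v \<in> X \<Longrightarrow> u \<in> X" for u v
    using that by (auto simp: F_def digonify_def)
  interpret F: vertex_critical W F k using crit by (simp add: F_def)
  interpret F: regular_critical W F k
  proof (rule F.regular_of_partition[of X])
    fix v assume "v \<in> W \<inter> X"
    then have "F `` {v} \<subseteq> E `` {v}" using F_in_E by blast
    from card_mono[OF finE(1) this] show "card (F `` {v}) \<le> k"
      using \<open>v \<in> W \<inter> X\<close> by (simp add: X_def)
  next
    fix v assume v: "v \<in> W - X"
    then have "F\<inverse> `` {v} \<subseteq> E\<inverse> `` {v}" using F_in_E by blast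
    from card_mono[OF finE(2) this] have "card (F\<inverse> `` {v}) \<le> card (E\<inverse> `` {v})" .
    also have "\<dots> \<le> k" using Y v W by blast
    finally show "card (F\<inverse> `` {v}) \<le> k" .
  next
    show "(u, v) \<in> F \<longleftrightarrow> (v, u) \<in> F" if "u \<in> X" "v \<notin> X" for u v
      using that by (auto simp: F_def digonify_def)
  qed
  have sym: "sym F" using F.arcs_symmetric[OF k2] by (rule symI)
  show ?thesis
  proof (cases "k = 2")
    case True
    \<comment> \<open>Otherwise the two parts would be the classes of a proper 2-colouring.\<close>
    have "\<exists>(u, v) \<in> F. u \<in> X \<longleftrightarrow> v \<in> X"
    proof (rule ccontr)
      assume "\<not> ?thesis"
      then have "dicol F k W (\<lambda>v. if v \<in> X then 1 else 2)"
        using True by (auto simp: dicol_sym_iff[OF sym])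
      then show False using F.not_dicol by blast
    qed
    then obtain u v where uv: "(u, v) \<in> F" "u \<in> X \<longleftrightarrow> v \<in> X" by blast
    then have "(u, v) \<in> E" "(v, u) \<in> E" using F_in_E sym by (auto dest: symD)
    then have "contains_subdigraph D (with_proj (bidirected_complete 2))"
      using E(2) unfolding E_def by (intro contains_digonI[OF wf_digraph, of u v]) auto
    then show ?thesis using True by (simp add: k_def)
  next
    case False
    then have k3: "3 \<le> k" using k2 by simp
    interpret F: symmetric_critical W F k by unfold_locales (use sym k3 in auto)
    have finW: "finite (W \<inter> X)" "finite (W - X)" using F.finite_V by auto
    obtain f where f: "bij_betw f {0..<card (W \<inter> X)} (W \<inter> X)"
      using ex_bij_betw_nat_finite[OF finW(1)] by blast
    obtain g where g: "bij_betw g {0..<card (W - X)} (W - X)"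
      using ex_bij_betw_nat_finite[OF finW(2)] by blast
    let ?r = "card (W \<inter> X)" and ?s = "card (W - X)"
    let ?J = "directed_join (bidirected_complete ?r) (bidirected_complete ?s)"
    let ?h = "case_sum f g"
    have h_in: "?h a \<in> W \<and> (?h a \<in> X \<longleftrightarrow> isl a)" if "a \<in> pverts ?J" for a
      using that bij_betwE[OF f] bij_betwE[OF g]
      by (cases a) (auto simp: directed_join_def bidirected_complete_def)
    have inj_h: "inj_on ?h (pverts ?J)"
    proof (rule inj_onI)
      fix a b assume ab: "a \<in> pverts ?J" "b \<in> pverts ?J" "?h a = ?h b"
      then have "isl a \<longleftrightarrow> isl b" using h_in by metis
      then show "a = b"
        using ab inj_on_eq_iff[OF bij_betw_imp_inj_on[OF f]]
          inj_on_eq_iff[OF bij_betw_imp_inj_on[OF g]]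
        by (cases a; cases b) (auto simp: directed_join_def bidirected_complete_def)
    qed
    have "contains_subdigraph D (with_proj ?J)"
    proof (rule contains_pair_digraphI[OF wf_digraph _ inj_h])
      show "pair_wf_digraph ?J"
        using pair_digraph_directed_join[OF pair_digraph_bidirected_complete
            pair_digraph_bidirected_complete]
        by (simp add: pair_digraph_def pair_fin_digraph_def)
      show "?h ` pverts ?J \<subseteq> verts D" using h_in W by blast
    next
      fix a b assume "(a, b) \<in> parcs ?J"
      then have ab: "a \<in> pverts ?J" "b \<in> pverts ?J" "a \<noteq> b" "isl b \<longrightarrow> isl a"
        by (auto simp: directed_join_def bidirected_complete_def)
      then have "?h a \<noteq> ?h b" using inj_onD[OF inj_h] by blast
      then have "(?h a, ?h b) \<in> F" using F.complete h_in ab(1,2) by blast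
      moreover have "?h a \<in> X" if "?h b \<in> X" using that h_in ab by blast
      ultimately show "(?h a, ?h b) \<in> arcs_ends D" using F_in_E unfolding E_def by blast
    qed
    moreover have "?r + ?s = k + 1"
      using F.card_V card_Un_disjoint[OF finW] by (simp add: Int_Diff_Un Int_Diff_disjoint)
    ultimately show ?thesis using k3 unfolding k_def by blast
  qed
qed simp

end
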